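(* Let $P_0,P_1$ be probability measures on a measurable space $\mathcal Y$ with $P_1\ll P_0$. Let $f:\mathcal Y\to[0,1]$ be a measurable nonconstant function (not $P_0$-almost surely constant), fixed independently of the samples below. Let $n_0\ge2$, $n_1\ge1$, let $Y_1^0,\dots,Y_{n_0}^0$ be i.i.d. from $P_0$ (clean calibration sample) and $Y_1^1,\dots,Y_{n_1}^1$ be i.i.d. from $P_1$ (seen calibration sample), and put $$\bar f_0=\frac1{n_0}\sum_{j=1}^{n_0}f(Y_j^0),\qquad \bar f_1=\frac1{n_1}\sum_{k=1}^{n_1}f(Y_k^1),\qquad \widehat\sigma_f^2=\frac1{n_0-1}\sum_{j=1}^{n_0}\bigl(f(Y_j^0)-\bar f_0\bigr)^2 .$$ For $\delta\in(0,1)$ define $$\varepsilon(n)=\sqrt{\frac{\log(6/\delta)}{2n}},\qquad u(n_0)=\sqrt{\frac{2\log(3/\delta)}{n_0-1}},\qquad \overline\sigma_f=\min\{1/2,\ \widehat\sigma_f+u(n_0)\},$$ $$\Delta_L=\bigl[\,|\bar f_1-\bar f_0|-\varepsilon(n_1)-\varepsilon(n_0)\bigr]_+,\qquad \underline e_f=\frac{\Delta_L}{\overline\sigma_f}.$$ Then, with probability at least $1-\delta$, $$\rho\ \ge\ e_f\ \ge\ \underline e_f .$$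
   Context: $[x]_+=\max\{x,0\}$. With $r=\mathrm dP_1/\mathrm dP_0$, $\rho\in[0,\infty]$ is defined by $\rho^2=\chi^2(P_1\Vert P_0)=\mathbb E_{P_0}[(r-1)^2]$. The efficacy of $f$ is $e_f=|\mathbb E_{P_1}f-\mathbb E_{P_0}f|/\sigma_f$ with $\sigma_f^2=\operatorname{Var}_{P_0}(f)>0$. *)

theory Defs
  imports "HOL-Probability.Probability"
begin

(* The density is converted to a real before 1 is subtracted, because subtraction on ennreal is
   truncated.  If P1 is absolutely continuous w.r.t. P0 and both are probability measures, then
   RN_deriv P0 P1 is finite P0-almost everywhere, so the conversion loses nothing. *)
definition chi_square :: "'y measure \<Rightarrow> 'y measure \<Rightarrow> ennreal" where
  "chi_square P1 P0 =
     (\<integral>\<^sup>+ y. ennreal ((enn2real (RN_deriv P0 P1 y) - 1)\<^sup>2) \<partial>P0)"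

definition rho :: "'y measure \<Rightarrow> 'y measure \<Rightarrow> ennreal" where
  "rho P1 P0 =
     (if chi_square P1 P0 = \<infinity> then \<infinity>
      else ennreal (sqrt (enn2real (chi_square P1 P0))))"

lemma rho_power2: "(rho P1 P0)\<^sup>2 = chi_square P1 P0"
proof (cases "chi_square P1 P0 = \<infinity>")
  case True
  then show ?thesis by (simp add: rho_def power2_eq_square)
next
  case False
  then show ?thesis by (simp add: rho_def ennreal_power less_top)
qed

definition std_dev :: "'y measure \<Rightarrow> ('y \<Rightarrow> real) \<Rightarrow> real" where
  "std_dev P f = sqrt (prob_space.variance P f)"

definition efficacy :: "'y measure \<Rightarrow> 'y measure \<Rightarrow> ('y \<Rightarrow> real) \<Rightarrow> real" where
  "efficacy P1 P0 f =
     \<bar>prob_space.expectation P1 f - prob_space.expectation P0 f\<bar> / std_dev P0 f"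

definition iid_sample ::
    "'w measure \<Rightarrow> 'y measure \<Rightarrow> nat \<Rightarrow> (nat \<Rightarrow> 'w \<Rightarrow> 'y) \<Rightarrow> bool" where
  "iid_sample M P n Y \<longleftrightarrow>
     prob_space.indep_vars M (\<lambda>_. P) Y {1..n} \<and> (\<forall>j\<in>{1..n}. distr M P (Y j) = P)"

definition sample_mean :: "nat \<Rightarrow> (nat \<Rightarrow> real) \<Rightarrow> real" where
  "sample_mean n x = (\<Sum>j=1..n. x j) / real n"

definition sample_std :: "nat \<Rightarrow> (nat \<Rightarrow> real) \<Rightarrow> real" where
  "sample_std n x = sqrt ((\<Sum>j=1..n. (x j - sample_mean n x)\<^sup>2) / (real n - 1))"

definition eps :: "real \<Rightarrow> nat \<Rightarrow> real" where
  "eps \<delta> n = sqrt (ln (6 / \<delta>) / (2 * real n))"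

definition u_dev :: "real \<Rightarrow> nat \<Rightarrow> real" where
  "u_dev \<delta> n = sqrt (2 * ln (3 / \<delta>) / (real n - 1))"

(* In the following, x0 j and x1 k are the values of f on the clean and on the seen sample. *)

definition sigma_upper :: "real \<Rightarrow> nat \<Rightarrow> (nat \<Rightarrow> real) \<Rightarrow> real" where
  "sigma_upper \<delta> n0 x0 = min (1 / 2) (sample_std n0 x0 + u_dev \<delta> n0)"

definition Delta_lower ::
    "real \<Rightarrow> nat \<Rightarrow> nat \<Rightarrow> (nat \<Rightarrow> real) \<Rightarrow> (nat \<Rightarrow> real) \<Rightarrow> real" where
  "Delta_lower \<delta> n0 n1 x0 x1 =
     max (\<bar>sample_mean n1 x1 - sample_mean n0 x0\<bar> - eps \<delta> n1 - eps \<delta> n0) 0"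

definition efficacy_lower ::
    "real \<Rightarrow> nat \<Rightarrow> nat \<Rightarrow> (nat \<Rightarrow> real) \<Rightarrow> (nat \<Rightarrow> real) \<Rightarrow> real" where
  "efficacy_lower \<delta> n0 n1 x0 x1 = Delta_lower \<delta> n0 n1 x0 x1 / sigma_upper \<delta> n0 x0"

end

theory Submission
  imports Defs "HOL-Combinatorics.Permutations"
begin

text \<open>
  The bound \<open>e\<^sub>f \<le> \<rho>\<close> is the Cauchy--Schwarz inequality for
  \<open>E\<^sub>1 f - E\<^sub>0 f = E\<^sub>0 [(r - 1) (f - E\<^sub>0 f)]\<close>. For the lower confidence bound, the two sample
  means and the sample standard deviation each fail their confidence bound with
  probability at most \<open>\<delta>/3\<close>; for the means this is Hoeffding's inequality.

  The sample standard deviation does not need the entropy method. With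
  \<open>m = \<lfloor>n/2\<rfloor>\<close>, the sample variance is the average over all permutations of the mean of
  \<open>m\<close> independent variables \<open>Z = (X - X')\<^sup>2 / 2\<close>, which take values in \<open>[0, 1/2]\<close> and satisfy
  \<open>E Z = \<sigma>\<^sup>2\<close>, \<open>E Z\<^sup>2 \<le> \<sigma>\<^sup>2/2\<close>. By Jensen's inequality the Laplace transform of the sample variance is
  bounded by that of such a mean, and the Chernoff bound gives the lower tail
  \<open>exp (- m u\<^sup>2) \<le> exp (- (n - 1) u\<^sup>2 / 2)\<close> at \<open>\<sigma> - u\<close>.
\<close>

section \<open>Sample variance as an average over permutations\<close>

text \<open>The symmetric group acts transitively on ordered pairs of distinct points: choose
  \<open>q\<close> with \<open>q c = a\<close> and \<open>q d = b\<close>; replacing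
  \<open>p\<close> by \<open>p o q\<close> only reorders the summation.\<close>

lemma sum_permutes_pair_eq:
  fixes g :: "'a \<Rightarrow> 'a \<Rightarrow> 'b::comm_monoid_add"
  assumes "a \<in> S" "b \<in> S" "a \<noteq> b" "c \<in> S" "d \<in> S" "c \<noteq> d"
  shows "(\<Sum>p | p permutes S. g (p a) (p b)) = (\<Sum>p | p permutes S. g (p c) (p d))"
proof -
  define q1 where "q1 = Transposition.transpose c a"
  define e where "e = q1 d"
  \<comment> \<open>The first transposition settles \<open>c\<close> but moves \<open>d\<close> to
    \<open>e\<close>. The second one moves \<open>e\<close> to \<open>b\<close> and leaves
    \<open>a\<close> fixed, because \<open>e\<close> and \<open>b\<close> both differ from
    \<open>a\<close>.\<close>
  define q where "q = Transposition.transpose e b \<circ> q1"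
  have q1: "q1 permutes S" unfolding q1_def using assms by (intro permutes_swap_id) auto
  have e: "e \<in> S" "e \<noteq> a" unfolding e_def using assms q1 permutes_in_image[OF q1]
    by (auto simp: q1_def Transposition.transpose_def)
  have q: "q permutes S" unfolding q_def using assms e q1
    by (intro permutes_compose permutes_swap_id) auto
  have qc: "q c = a" using assms e by (auto simp: q_def q1_def Transposition.transpose_def)
  have qd: "q d = b" by (simp add: q_def e_def)
  show ?thesis
    by (subst (2) sum_permutations_compose_right[OF q]) (simp add: qc qd)
qed

text \<open>Double counting of the sum of \<open>g (p c) (p d)\<close> over \<open>c\<close>,
  \<open>d\<close> and \<open>p\<close>. Summed over \<open>p\<close> first, every off-diagonal pair
  gives the same value and the diagonal vanishes; summed over \<open>c\<close> and \<open>d\<close>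
  first, \<open>p\<close> merely reindexes \<open>S\<close>, so all permutations contribute
  equally.\<close>

lemma sum_permutes_pair:
  fixes g :: "'a \<Rightarrow> 'a \<Rightarrow> real"
  assumes S: "finite S" and ab: "a \<in> S" "b \<in> S" "a \<noteq> b"
    and diag: "\<And>x. x \<in> S \<Longrightarrow> g x x = 0"
  shows "real (card S) * (real (card S) - 1) * (\<Sum>p | p permutes S. g (p a) (p b)) =
           fact (card S) * (\<Sum>c\<in>S. \<Sum>d\<in>S. g c d)"
proof -
  let ?P = "{p. p permutes S}"
  define G where "G = (\<Sum>p\<in>?P. g (p a) (p b))"
  have "(\<Sum>c\<in>S. \<Sum>d\<in>S. \<Sum>p\<in>?P. g (p c) (p d)) = (\<Sum>c\<in>S. \<Sum>d\<in>S. if c = d then 0 else G)"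
  proof (intro sum.cong refl)
    fix c d assume cd: "c \<in> S" "d \<in> S"
    show "(\<Sum>p\<in>?P. g (p c) (p d)) = (if c = d then 0 else G)"
    proof (cases "c = d")
      case True
      then show ?thesis using cd by (auto intro!: sum.neutral diag simp: permutes_in_image)
    next
      case False
      then show ?thesis using sum_permutes_pair_eq[OF ab cd, of g] by (simp add: G_def)
    qed
  qed
  also have "\<dots> = (\<Sum>c\<in>S. (\<Sum>d\<in>S. G) - (\<Sum>d\<in>S. if c = d then G else 0))"
    by (subst sum_subtractf[symmetric]) (intro sum.cong refl, simp)
  also have "\<dots> = real (card S) * (real (card S) - 1) * G"
    using S by (simp add: algebra_simps)
  finally have 1: "(\<Sum>c\<in>S. \<Sum>d\<in>S. \<Sum>p\<in>?P. g (p c) (p d)) = real (card S) * (real (card S) - 1) * G" .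
  have "(\<Sum>c\<in>S. \<Sum>d\<in>S. \<Sum>p\<in>?P. g (p c) (p d)) = (\<Sum>c\<in>S. \<Sum>p\<in>?P. \<Sum>d\<in>S. g (p c) (p d))"
    by (intro sum.cong refl sum.swap)
  also have "\<dots> = (\<Sum>p\<in>?P. \<Sum>c\<in>S. \<Sum>d\<in>S. g (p c) (p d))"
    by (rule sum.swap)
  also have "\<dots> = (\<Sum>p\<in>?P. \<Sum>c\<in>S. \<Sum>d\<in>S. g c d)"
  proof (rule sum.cong[OF refl])
    fix p assume "p \<in> ?P"
    then have p: "p permutes S" by simp
    have "(\<Sum>c\<in>S. \<Sum>d\<in>S. g (p c) (p d)) = (\<Sum>c\<in>S. \<Sum>d\<in>S. g (p c) d)"
      by (intro sum.cong refl sum.reindex_bij_betw permutes_imp_bij p)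
    also have "\<dots> = (\<Sum>c\<in>S. \<Sum>d\<in>S. g c d)"
      by (intro sum.reindex_bij_betw permutes_imp_bij p)
    finally show "(\<Sum>c\<in>S. \<Sum>d\<in>S. g (p c) (p d)) = (\<Sum>c\<in>S. \<Sum>d\<in>S. g c d)" .
  qed
  also have "\<dots> = fact (card S) * (\<Sum>c\<in>S. \<Sum>d\<in>S. g c d)"
    using card_permutations[OF refl S] by simp
  finally show ?thesis using 1 by (simp add: G_def)
qed

text \<open>Both sides reduce to the sum \<open>s\<close> and the sum of squares \<open>q\<close>.
  This makes the sample variance a U-statistic with kernel \<open>(x - y)^2 / 2\<close>.\<close>

lemma sum_sq_dev_pairs:
  assumes "n \<noteq> 0"
  shows "(\<Sum>j=1..n. (x j - sample_mean n x)\<^sup>2) = (\<Sum>a=1..n. \<Sum>b=1..n. (x a - x b)\<^sup>2) / (2 * real n)"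
proof -
  define s where "s = (\<Sum>j=1..n. x j)"
  define q where "q = (\<Sum>j=1..n. (x j)\<^sup>2)"
  have m: "sample_mean n x = s / n" by (simp add: sample_mean_def s_def)
  have "(\<Sum>j=1..n. (x j - s/n)\<^sup>2) = (\<Sum>j=1..n. (x j)\<^sup>2 - 2 * (s/n) * x j + (s/n)\<^sup>2)"
    by (intro sum.cong refl) (simp add: power2_eq_square algebra_simps)
  also have "\<dots> = q - 2 * (s/n) * s + n * (s/n)\<^sup>2"
    by (simp add: sum.distrib sum_subtractf q_def s_def sum_distrib_left)
  also have "\<dots> = q - s\<^sup>2 / n" using assms by (simp add: field_simps power2_eq_square)
  finally have 1: "(\<Sum>j=1..n. (x j - s/n)\<^sup>2) = q - s\<^sup>2 / n" .
  have "(\<Sum>a=1..n. \<Sum>b=1..n. (x a - x b)\<^sup>2) = (\<Sum>a=1..n. \<Sum>b=1..n. (x a)\<^sup>2 + (x b)\<^sup>2 - 2 * x a * x b)"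
    by (intro sum.cong refl) (simp add: power2_eq_square algebra_simps)
  also have "\<dots> = (\<Sum>a=1..n. n * (x a)\<^sup>2 + q - 2 * x a * s)"
    by (simp add: sum.distrib sum_subtractf q_def s_def sum_distrib_left)
  also have "\<dots> = n * q + n * q - 2 * s * s"
    by (simp add: sum.distrib sum_subtractf mult.assoc flip: sum_distrib_left sum_distrib_right)
       (simp add: q_def s_def)
  finally show ?thesis using 1 assms by (simp add: m field_simps power2_eq_square)
qed

text \<open>Hoeffding's device for U-statistics: under one permutation the pairs are disjoint, so
  for independent data their terms are independent, while the average over all permutations recovers
  every pair equally often. For odd \<open>n\<close> each permutation leaves out the value at its
  last position.\<close>

lemma sample_variance_eq_permutation_average:
  assumes n: "n \<ge> 2"
  shows "(\<Sum>j=1..n. (x j - sample_mean n x)\<^sup>2) / (real n - 1) =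
    (\<Sum>p | p permutes {1..n}. 1 / fact n *
       (\<Sum>i<n div 2. (x (p (2*i+1)) - x (p (2*i+2)))\<^sup>2 / 2 / real (n div 2)))"
proof -
  let ?P = "{p. p permutes {1..n}}"
  define D where "D = (\<Sum>a=1..n. \<Sum>b=1..n. (x a - x b)\<^sup>2)"
  have n': "real n * (real n - 1) > 0" "real (n div 2) > 0" using n by auto
  let ?A = "\<lambda>p i. (x (p (2*i+1)) - x (p (2*i+2)))\<^sup>2"
  have "(\<Sum>p\<in>?P. 1 / fact n * (\<Sum>i<n div 2. ?A p i / 2 / real (n div 2))) =
      1 / fact n * (\<Sum>p\<in>?P. \<Sum>i<n div 2. ?A p i / 2 / real (n div 2))"
    by (simp only: sum_distrib_left)
  also have "\<dots> = 1 / fact n * (\<Sum>i<n div 2. \<Sum>p\<in>?P. ?A p i / 2 / real (n div 2))"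
    by (subst sum.swap) (rule refl)
  also have "\<dots> = 1 / fact n * (\<Sum>i<n div 2. (\<Sum>p\<in>?P. ?A p i) / 2 / real (n div 2))"
    by (simp only: sum_divide_distrib)
  also have "\<dots> = 1 / fact n * (\<Sum>i<n div 2. (fact n * D / (real n * (real n - 1))) / 2 / real (n div 2))"
  proof -
    \<comment> \<open>The value does not depend on the slot \<open>i\<close>, so the mean over the
      \<open>n div 2\<close> slots is this common value.\<close>
    have "(\<Sum>p\<in>?P. (x (p (2*i+1)) - x (p (2*i+2)))\<^sup>2) = fact n * D / (real n * (real n - 1))"
      if "i < n div 2" for i
    proof -
      have "2 * i + 2 \<le> n" using that by linarith
      then have "real n * (real n - 1) * (\<Sum>p\<in>?P. (x (p (2*i+1)) - x (p (2*i+2)))\<^sup>2) = fact n * D"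
        using sum_permutes_pair[of "{1..n}" "2*i+1" "2*i+2" "\<lambda>a b. (x a - x b)\<^sup>2"]
        by (simp add: D_def)
      then show ?thesis by (subst nonzero_eq_divide_eq[OF less_imp_neq[OF n'(1), symmetric]]) (simp only: mult.commute)
    qed
    then show ?thesis by simp
  qed
  also have "\<dots> = D / (real n * (real n - 1)) / 2"
  proof -
    have "1 / F * (k * (F * D / N / 2 / k)) = D / N / 2" if "F \<noteq> 0" "k \<noteq> 0" for F k N :: real
      using that by simp
    from this[of "fact n" "real (n div 2)"] n'(2) show ?thesis by simp
  qed
  also have "\<dots> = (\<Sum>j=1..n. (x j - sample_mean n x)\<^sup>2) / (real n - 1)"
    using n by (subst sum_sq_dev_pairs) (auto simp: D_def)
  finally show ?thesis by simp
qed

section \<open>Laplace transforms of halved squared differences\<close>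

text \<open>The quadratic lower bound for \<open>exp x\<close> is inverted: its product with the
  claimed upper bound is \<open>1 + x^4 / 4\<close>, which is at least 1.\<close>

lemma exp_neg_le_quadratic:
  fixes x :: real
  assumes "x \<ge> 0"
  shows "exp (- x) \<le> 1 - x + x\<^sup>2 / 2"
proof -
  have 1: "1 + x + x\<^sup>2 / 2 \<le> exp x" using exp_lower_Taylor_quadratic[OF assms] .
  have pos: "1 - x + x\<^sup>2 / 2 > 0"
    using zero_le_power2[of "x - 1"] by (simp add: power2_eq_square algebra_simps)
  have "(1 - x + x\<^sup>2/2) * (1 + x + x\<^sup>2/2) = 1 + (x\<^sup>2)\<^sup>2/4"
    by (simp add: power2_eq_square algebra_simps)
  then have "1 \<le> (1 - x + x\<^sup>2/2) * (1 + x + x\<^sup>2/2)" by simp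
  also have "\<dots> \<le> (1 - x + x\<^sup>2/2) * exp x" using 1 pos by (intro mult_left_mono) auto
  finally show ?thesis by (simp add: exp_minus field_simps)
qed

context prob_space
begin

text \<open>In the expanded square, independence turns the cross term into
  \<open>\<mu> * \<mu>\<close>, which cancels the squared means of the other two terms.\<close>

lemma expectation_half_sq_diff:
  fixes X :: "'i \<Rightarrow> 'a \<Rightarrow> real"
  assumes ind: "indep_vars (\<lambda>_. borel) X I" and ab: "a \<in> I" "b \<in> I" "a \<noteq> b"
    and bd: "\<And>i \<omega>. i \<in> I \<Longrightarrow> \<omega> \<in> space M \<Longrightarrow> X i \<omega> \<in> {0..1}"
    and mean: "\<And>i. i \<in> I \<Longrightarrow> expectation (X i) = \<mu>"
    and var: "\<And>i. i \<in> I \<Longrightarrow> variance (X i) = v"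
  shows "expectation (\<lambda>\<omega>. (X a \<omega> - X b \<omega>)\<^sup>2 / 2) = v"
proof -
  have rv [measurable]: "random_variable borel (X a)" "random_variable borel (X b)"
    using ind ab by (auto simp: indep_vars_def)
  have int: "integrable M (X i)" "integrable M (\<lambda>\<omega>. (X i \<omega>)\<^sup>2)" if "i \<in> I" for i
  proof -
    have [measurable]: "random_variable borel (X i)"
      using ind that by (auto simp: indep_vars_def)
    show "integrable M (X i)" "integrable M (\<lambda>\<omega>. (X i \<omega>)\<^sup>2)"
      using bd[OF that] by (intro integrable_const_bound[where B = 1] AE_I2; auto intro: power_le_one)+
  qed
  have ind2: "indep_vars (\<lambda>_. borel) X {a, b}"
    using indep_vars_subset[OF ind] ab by auto
  have prod: "expectation (\<lambda>\<omega>. X a \<omega> * X b \<omega>) = \<mu> * \<mu>" "integrable M (\<lambda>\<omega>. X a \<omega> * X b \<omega>)"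
    using indep_vars_lebesgue_integral[OF _ ind2] indep_vars_integrable[OF _ ind2] ab int mean by auto
  have sq: "expectation (\<lambda>\<omega>. (X i \<omega>)\<^sup>2) = v + \<mu>\<^sup>2" if "i \<in> I" for i
    using variance_eq[OF int[OF that]] var mean that by simp
  have "expectation (\<lambda>\<omega>. (X a \<omega> - X b \<omega>)\<^sup>2 / 2) =
        expectation (\<lambda>\<omega>. (X a \<omega>)\<^sup>2 / 2 + (X b \<omega>)\<^sup>2 / 2 - X a \<omega> * X b \<omega>)"
    by (intro Bochner_Integration.integral_cong refl) (simp add: power2_eq_square field_simps)
  also have "\<dots> = (v + \<mu>\<^sup>2) / 2 + (v + \<mu>\<^sup>2) / 2 - \<mu> * \<mu>"
    using int ab prod sq by simp
  finally show ?thesis by (simp add: power2_eq_square field_simps)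
qed

text \<open>Since \<open>Z\<close> lies in \<open>[0, 1/2]\<close>, \<open>Z * Z\<close> is at most
  \<open>Z / 2\<close>. The quadratic bound on \<open>exp (- t * Z)\<close> thus becomes affine in
  \<open>Z\<close>, and the exponent is proportional to the variance \<open>v\<close>; this
  proportionality later gives a deviation bound for the standard deviation that is free of
  \<open>v\<close>.\<close>

lemma mgf_half_sq_diff_le:
  fixes X :: "'i \<Rightarrow> 'a \<Rightarrow> real"
  assumes ind: "indep_vars (\<lambda>_. borel) X I" and ab: "a \<in> I" "b \<in> I" "a \<noteq> b"
    and bd: "\<And>i \<omega>. i \<in> I \<Longrightarrow> \<omega> \<in> space M \<Longrightarrow> X i \<omega> \<in> {0..1}"
    and mean: "\<And>i. i \<in> I \<Longrightarrow> expectation (X i) = \<mu>"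
    and var: "\<And>i. i \<in> I \<Longrightarrow> variance (X i) = v"
    and t: "t \<ge> 0"
  shows "expectation (\<lambda>\<omega>. exp (- t * ((X a \<omega> - X b \<omega>)\<^sup>2 / 2))) \<le> exp (v * (t\<^sup>2 / 4 - t))"
proof -
  have [measurable]: "random_variable borel (X a)" "random_variable borel (X b)"
    using ind ab by (auto simp: indep_vars_def)
  define Z where "Z \<omega> = (X a \<omega> - X b \<omega>)\<^sup>2 / 2" for \<omega>
  have [measurable]: "Z \<in> borel_measurable M" unfolding Z_def by measurable
  have Z: "0 \<le> Z \<omega>" "Z \<omega> \<le> 1 / 2" if "\<omega> \<in> space M" for \<omega>
  proof -
    have "\<bar>X a \<omega> - X b \<omega>\<bar> \<le> 1" using bd[OF ab(1) that] bd[OF ab(2) that] by auto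
    then have "(X a \<omega> - X b \<omega>)\<^sup>2 \<le> 1" by (simp add: abs_square_le_1)
    then show "0 \<le> Z \<omega>" "Z \<omega> \<le> 1 / 2" by (auto simp: Z_def)
  qed
  have intZ: "integrable M Z"
    using Z by (intro integrable_const_bound[where B = "1/2"] AE_I2) auto
  have "expectation (\<lambda>\<omega>. exp (- t * Z \<omega>)) \<le> expectation (\<lambda>\<omega>. 1 + (t\<^sup>2 / 4 - t) * Z \<omega>)"
  proof (rule integral_mono)
    show "integrable M (\<lambda>\<omega>. exp (- t * Z \<omega>))"
      using Z t by (intro integrable_const_bound[where B = 1] AE_I2) auto
    show "integrable M (\<lambda>\<omega>. 1 + (t\<^sup>2 / 4 - t) * Z \<omega>)"
      using intZ by auto
    fix \<omega> assume \<omega>: "\<omega> \<in> space M"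
    have "exp (- t * Z \<omega>) \<le> 1 - t * Z \<omega> + t\<^sup>2 / 2 * (Z \<omega> * Z \<omega>)"
      using exp_neg_le_quadratic[of "t * Z \<omega>"] Z[OF \<omega>] t by (simp add: power2_eq_square mult_ac)
    also have "\<dots> \<le> 1 - t * Z \<omega> + t\<^sup>2 / 2 * (1 / 2 * Z \<omega>)"
      using Z[OF \<omega>] by (intro add_mono mult_left_mono mult_right_mono) auto
    finally show "exp (- t * Z \<omega>) \<le> 1 + (t\<^sup>2 / 4 - t) * Z \<omega>" by (simp add: algebra_simps)
  qed
  also have "\<dots> = 1 + v * (t\<^sup>2 / 4 - t)"
  proof -
    have "expectation Z = v"
      using expectation_half_sq_diff[OF ind ab bd mean var] by (simp add: Z_def[abs_def])
    then show ?thesis using intZ by (simp add: prob_space)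
  qed
  also have "\<dots> \<le> exp (v * (t\<^sup>2 / 4 - t))" by (rule exp_ge_add_one_self)
  finally show ?thesis by (simp add: Z_def)
qed

text \<open>Disjoint pairs of independent variables form independent blocks, so the Laplace
  transform of the sum factorizes into the single-pair ones.\<close>

lemma mgf_sum_half_sq_diff_le:
  fixes X :: "'i \<Rightarrow> 'a \<Rightarrow> real"
  assumes ind: "indep_vars (\<lambda>_. borel) X I"
    and bd: "\<And>i \<omega>. i \<in> I \<Longrightarrow> \<omega> \<in> space M \<Longrightarrow> X i \<omega> \<in> {0..1}"
    and mean: "\<And>i. i \<in> I \<Longrightarrow> expectation (X i) = \<mu>"
    and var: "\<And>i. i \<in> I \<Longrightarrow> variance (X i) = v"
    and t: "t \<ge> 0" and L: "finite L"
    and ab: "\<And>l. l \<in> L \<Longrightarrow> a l \<in> I" "\<And>l. l \<in> L \<Longrightarrow> b l \<in> I" "\<And>l. l \<in> L \<Longrightarrow> a l \<noteq> b l"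
    and disj: "disjoint_family_on (\<lambda>l. {a l, b l}) L"
  shows "expectation (\<lambda>\<omega>. exp (- t * (\<Sum>l\<in>L. (X (a l) \<omega> - X (b l) \<omega>)\<^sup>2 / 2)))
           \<le> exp (card L * (v * (t\<^sup>2 / 4 - t)))"
proof -
  have rv: "random_variable borel (X i)" if "i \<in> I" for i
    using ind that by (auto simp: indep_vars_def)
  define W where "W l \<omega> = exp (- t * ((X (a l) \<omega> - X (b l) \<omega>)\<^sup>2 / 2))" for l \<omega>
  \<comment> \<open>Independence is first stated for the blocks as random vectors, then pushed
    through a measurable function of each block.\<close>
  have "indep_vars (\<lambda>l. PiM {a l, b l} (\<lambda>_. borel)) (\<lambda>l \<omega>. restrict (\<lambda>i. X i \<omega>) {a l, b l}) L"
    using ab by (intro indep_vars_restrict[OF ind _ disj]) auto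
  then have "indep_vars (\<lambda>_. borel)
      (\<lambda>l \<omega>. (\<lambda>y. exp (- t * ((y (a l) - y (b l))\<^sup>2 / 2))) (restrict (\<lambda>i. X i \<omega>) {a l, b l})) L"
    by (rule indep_vars_compose2) measurable
  then have indW: "indep_vars (\<lambda>_. borel) W L" by (simp add: W_def[abs_def])
  have intW: "integrable M (W l)" if "l \<in> L" for l
  proof -
    note [measurable] = rv[OF ab(1)[OF that]] rv[OF ab(2)[OF that]]
    show ?thesis unfolding W_def using t by (intro integrable_const_bound[where B = 1] AE_I2) auto
  qed
  have "expectation (\<lambda>\<omega>. exp (- t * (\<Sum>l\<in>L. (X (a l) \<omega> - X (b l) \<omega>)\<^sup>2 / 2)))
      = expectation (\<lambda>\<omega>. \<Prod>l\<in>L. W l \<omega>)"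
    using L by (simp add: W_def sum_distrib_left exp_sum sum_negf flip: exp_sum)
  also have "\<dots> = (\<Prod>l\<in>L. expectation (W l))"
    by (rule indep_vars_lebesgue_integral[OF L indW intW])
  also have "\<dots> \<le> (\<Prod>l\<in>L. exp (v * (t\<^sup>2 / 4 - t)))"
    unfolding W_def
    by (intro prod_mono conjI mgf_half_sq_diff_le[OF ind ab bd mean var t] integral_nonneg_AE) auto
  also have "\<dots> = exp (card L * (v * (t\<^sup>2 / 4 - t)))"
    by (simp add: exp_of_nat_mult)
  finally show ?thesis .
qed

end

section \<open>Tail bounds for the sample mean and the sample standard deviation\<close>

lemma sample_std_nonneg: "n \<ge> 1 \<Longrightarrow> sample_std n x \<ge> 0"
  by (simp add: sample_std_def sum_nonneg)

lemma borel_measurable_sample_mean: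
  assumes "\<And>j. j \<in> {1..n} \<Longrightarrow> X j \<in> borel_measurable M"
  shows "(\<lambda>\<omega>. sample_mean n (\<lambda>j. X j \<omega>)) \<in> borel_measurable M"
  unfolding sample_mean_def using assms by (intro borel_measurable_divide borel_measurable_sum) auto

lemma borel_measurable_sample_std:
  assumes "\<And>j. j \<in> {1..n} \<Longrightarrow> X j \<in> borel_measurable M"
  shows "(\<lambda>\<omega>. sample_std n (\<lambda>j. X j \<omega>)) \<in> borel_measurable M"
  unfolding sample_std_def using assms
  by (intro measurable_compose[OF _ borel_measurable_sqrt] borel_measurable_divide borel_measurable_sum borel_measurable_power
      borel_measurable_diff borel_measurable_sample_mean) auto

context prob_space
begin

text \<open>Hoeffding's inequality for the sum at deviation \<open>n * \<epsilon>\<close>; the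
  ranges have length 1, so their squares add up to \<open>n\<close>.\<close>

lemma sample_mean_tail:
  fixes X :: "nat \<Rightarrow> 'a \<Rightarrow> real"
  assumes ind: "indep_vars (\<lambda>_. borel) X {1..n}" and n: "n \<ge> 1"
    and bd: "\<And>i \<omega>. i \<in> {1..n} \<Longrightarrow> \<omega> \<in> space M \<Longrightarrow> X i \<omega> \<in> {0..1}"
    and mean: "\<And>i. i \<in> {1..n} \<Longrightarrow> expectation (X i) = \<mu>"
    and \<epsilon>: "\<epsilon> \<ge> 0"
  shows "prob {\<omega> \<in> space M. \<bar>sample_mean n (\<lambda>j. X j \<omega>) - \<mu>\<bar> \<ge> \<epsilon>} \<le> 2 * exp (- 2 * real n * \<epsilon>\<^sup>2)"
proof -
  interpret Hoeffding_ineq M "{1..n}" X "\<lambda>_. 0" "\<lambda>_. 1" "\<Sum>i=1..n. expectation (X i)"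
    using ind bd by unfold_locales auto
  have "\<bar>sample_mean n (\<lambda>j. X j \<omega>) - \<mu>\<bar> \<ge> \<epsilon> \<longleftrightarrow>
        \<bar>(\<Sum>i=1..n. X i \<omega>) - (\<Sum>i=1..n. expectation (X i))\<bar> \<ge> n * \<epsilon>" for \<omega>
  proof -
    have "sample_mean n (\<lambda>j. X j \<omega>) - \<mu> = ((\<Sum>i=1..n. X i \<omega>) - n * \<mu>) / n"
      using n by (simp add: sample_mean_def field_simps)
    moreover have "(\<Sum>i=1..n. expectation (X i)) = n * \<mu>" using mean by simp
    ultimately show ?thesis using n by (simp add: pos_le_divide_eq mult.commute)
  qed
  then have "prob {\<omega> \<in> space M. \<bar>sample_mean n (\<lambda>j. X j \<omega>) - \<mu>\<bar> \<ge> \<epsilon>} =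
    prob {\<omega> \<in> space M. \<bar>(\<Sum>i=1..n. X i \<omega>) - (\<Sum>i=1..n. expectation (X i))\<bar> \<ge> n * \<epsilon>}"
    by simp
  also have "\<dots> \<le> 2 * exp (- 2 * (real n * \<epsilon>)\<^sup>2 / (\<Sum>i=1..n. (1 - 0)\<^sup>2))"
    using n \<epsilon> by (intro Hoeffding_ineq_abs_ge) auto
  also have "- 2 * (real n * \<epsilon>)\<^sup>2 / (\<Sum>i=1..n. (1 - 0)\<^sup>2) = - 2 * real n * \<epsilon>\<^sup>2"
    using n by (simp add: power2_eq_square field_simps)
  finally show ?thesis .
qed

text \<open>Jensen's inequality moves the average over permutations out of the exponential, and each
  permutation then falls under the bound for disjoint pairs. The factor \<open>n div 2\<close> in
  the parameter turns the mean over pairs into their sum \<open>A p\<close>.\<close>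

lemma sample_variance_mgf_le:
  fixes X :: "nat \<Rightarrow> 'a \<Rightarrow> real"
  assumes ind: "indep_vars (\<lambda>_. borel) X {1..n}" and n: "n \<ge> 2"
    and bd: "\<And>i \<omega>. i \<in> {1..n} \<Longrightarrow> \<omega> \<in> space M \<Longrightarrow> X i \<omega> \<in> {0..1}"
    and mean: "\<And>i. i \<in> {1..n} \<Longrightarrow> expectation (X i) = \<mu>"
    and var: "\<And>i. i \<in> {1..n} \<Longrightarrow> variance (X i) = v"
    and t: "t \<ge> 0"
  shows "expectation (\<lambda>\<omega>. exp (- (t * real (n div 2)) * (sample_std n (\<lambda>j. X j \<omega>))\<^sup>2))
           \<le> exp (real (n div 2) * (v * (t\<^sup>2 / 4 - t)))"
proof -
  define m where "m = n div 2"
  have m: "m > 0" using n by (auto simp: m_def)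
  let ?P = "{p. p permutes {1..n}}"
  have finP: "finite ?P" by (simp add: finite_permutations)
  have idP: "id \<in> ?P" by (simp add: permutes_id)
  have cardP: "card ?P = fact n" using card_permutations[of "{1..n}" n] by simp
  have rv: "random_variable borel (X i)" if "i \<in> {1..n}" for i
    using ind that by (auto simp: indep_vars_def)
  define A where "A p \<omega> = (\<Sum>i<m. (X (p (2*i+1)) \<omega> - X (p (2*i+2)) \<omega>)\<^sup>2 / 2)" for p \<omega>
  have A0: "A p \<omega> \<ge> 0" for p \<omega> by (auto simp: A_def intro!: sum_nonneg)
  have mem: "p (2*i+1) \<in> {1..n}" "p (2*i+2) \<in> {1..n}" if "p \<in> ?P" "i < m" for p i
  proof -
    have "2*i+2 \<le> n" using that by (simp add: m_def)
    then show "p (2*i+1) \<in> {1..n}" "p (2*i+2) \<in> {1..n}"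
      using that permutes_in_image[of p "{1..n}"] by auto
  qed
  have rvA: "A p \<in> borel_measurable M" if "p \<in> ?P" for p
    unfolding A_def
    by (intro borel_measurable_sum borel_measurable_divide borel_measurable_power
        borel_measurable_diff rv mem that) auto
  have intA: "integrable M (\<lambda>\<omega>. exp (- t * A p \<omega>))" if "p \<in> ?P" for p
  proof -
    note [measurable] = rvA[OF that]
    show ?thesis using A0 t by (intro integrable_const_bound[where B = 1] AE_I2) auto
  qed
  have std: "(sample_std n (\<lambda>j. X j \<omega>))\<^sup>2 = (\<Sum>p\<in>?P. 1 / fact n * (A p \<omega> / m))" for \<omega>
  proof -
    have "(sample_std n (\<lambda>j. X j \<omega>))\<^sup>2 =
        (\<Sum>j=1..n. (X j \<omega> - sample_mean n (\<lambda>j. X j \<omega>))\<^sup>2) / (real n - 1)"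
      using n by (simp add: sample_std_def sum_nonneg)
    then show ?thesis
      using sample_variance_eq_permutation_average[OF n, of "\<lambda>j. X j \<omega>"]
      by (simp add: A_def m_def sum_divide_distrib)
  qed
  have "expectation (\<lambda>\<omega>. exp (- (t * m) * (sample_std n (\<lambda>j. X j \<omega>))\<^sup>2)) \<le>
        expectation (\<lambda>\<omega>. \<Sum>p\<in>?P. 1 / fact n * exp (- t * A p \<omega>))"
  proof (rule integral_mono)
    have [measurable]: "(\<lambda>\<omega>. sample_std n (\<lambda>j. X j \<omega>)) \<in> borel_measurable M"
      by (intro borel_measurable_sample_std rv)
    show "integrable M (\<lambda>\<omega>. exp (- (t * m) * (sample_std n (\<lambda>j. X j \<omega>))\<^sup>2))"
      using t by (intro integrable_const_bound[where B = 1] AE_I2) auto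
    show "integrable M (\<lambda>\<omega>. \<Sum>p\<in>?P. 1 / fact n * exp (- t * A p \<omega>))"
      by (intro Bochner_Integration.integrable_sum integrable_mult_right intA)
    fix \<omega>
    have "- (t * m) * (sample_std n (\<lambda>j. X j \<omega>))\<^sup>2 = (\<Sum>p\<in>?P. (1 / fact n) *\<^sub>R (- t * A p \<omega>))"
      using m by (simp add: std sum_distrib_left)
    \<comment> \<open>Convexity of \<open>exp\<close> with equal weights; \<open>idP\<close> makes
      the index set nonempty and \<open>cardP\<close> makes the weights sum to 1.\<close>
    also have "exp \<dots> \<le> (\<Sum>p\<in>?P. 1 / fact n * exp (- t * A p \<omega>))"
      using idP finP cardP convex_on_exp[of 1]
      by (intro convex_on_sum[where C = UNIV]) (auto simp del: mem_Collect_eq)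
    finally show "exp (- (t * m) * (sample_std n (\<lambda>j. X j \<omega>))\<^sup>2) \<le>
        (\<Sum>p\<in>?P. 1 / fact n * exp (- t * A p \<omega>))" by simp
  qed
  also have "\<dots> = (\<Sum>p\<in>?P. 1 / fact n * expectation (\<lambda>\<omega>. exp (- t * A p \<omega>)))"
  proof (subst Bochner_Integration.integral_sum)
    show "integrable M (\<lambda>\<omega>. 1 / fact n * exp (- t * A p \<omega>))" if "p \<in> ?P" for p
      by (intro integrable_mult_right intA that)
  qed simp
  also have "\<dots> \<le> (\<Sum>p\<in>?P. 1 / fact n * exp (m * (v * (t\<^sup>2 / 4 - t))))"
  proof (intro sum_mono mult_left_mono)
    fix p assume p: "p \<in> ?P"
    then have inj: "inj p" by (simp add: permutes_inj)
    have "expectation (\<lambda>\<omega>. exp (- t * A p \<omega>)) \<le> exp (card {..<m} * (v * (t\<^sup>2 / 4 - t)))"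
      unfolding A_def
    proof (rule mgf_sum_half_sq_diff_le[OF ind bd mean var t])
      show "disjoint_family_on (\<lambda>i. {p (2*i+1), p (2*i+2)}) {..<m}"
        unfolding disjoint_family_on_def
      proof (intro ballI impI)
        fix i j :: nat assume "i \<noteq> j"
        \<comment> \<open>Distinct slots use distinct positions, by parity in the mixed cases;
          injectivity of \<open>p\<close> carries this over to the indices.\<close>
        then have "2*i+1 \<noteq> 2*j+1" "2*i+2 \<noteq> 2*j+2" "2*i+1 \<noteq> 2*j+2" "2*i+2 \<noteq> 2*j+1"
          by presburger+
        then show "{p (2*i+1), p (2*i+2)} \<inter> {p (2*j+1), p (2*j+2)} = {}"
          using inj_eq[OF inj] by simp
      qed
      show "p (2*i+1) \<noteq> p (2*i+2)" for i
        using inj_eq[OF inj] by simp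
    qed (use mem p in auto)
    then show "expectation (\<lambda>\<omega>. exp (- t * A p \<omega>)) \<le> exp (m * (v * (t\<^sup>2 / 4 - t)))" by simp
  qed auto
  also have "\<dots> = exp (m * (v * (t\<^sup>2 / 4 - t)))" using cardP by simp
  finally show ?thesis by (simp add: m_def)
qed

text \<open>Chernoff bound for the sample variance at the threshold \<open>s^2 - s * u\<close>,
  where \<open>s = sqrt v\<close>. With the chosen \<open>t\<close>, the scale \<open>s\<close>
  cancels from the exponent.\<close>

lemma sample_std_lower_tail:
  fixes X :: "nat \<Rightarrow> 'a \<Rightarrow> real"
  assumes ind: "indep_vars (\<lambda>_. borel) X {1..n}" and n: "n \<ge> 2"
    and bd: "\<And>i \<omega>. i \<in> {1..n} \<Longrightarrow> \<omega> \<in> space M \<Longrightarrow> X i \<omega> \<in> {0..1}"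
    and mean: "\<And>i. i \<in> {1..n} \<Longrightarrow> expectation (X i) = \<mu>"
    and var: "\<And>i. i \<in> {1..n} \<Longrightarrow> variance (X i) = v"
    and v: "v > 0" and u: "u > 0"
  shows "prob {\<omega> \<in> space M. sample_std n (\<lambda>j. X j \<omega>) + u \<le> sqrt v} \<le> exp (- (real n - 1) * u\<^sup>2 / 2)"
proof -
  define m where "m = real (n div 2)"
  \<comment> \<open>The loss from rounding \<open>n / 2\<close> down is what produces
    \<open>n - 1\<close> in the final exponent.\<close>
  have m: "m > 0" "m \<ge> (real n - 1) / 2" 
  proof -
    have "n div 2 > 0" "n \<le> 2 * (n div 2) + 1" using n by auto
    from this(1) of_nat_mono[OF this(2), where 'a = real] show "m > 0" "m \<ge> (real n - 1) / 2"
      unfolding m_def by simp_all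
  qed
  define s where "s = sqrt v"
  have s: "s > 0" "v = s\<^sup>2" using v by (auto simp: s_def)
  \<comment> \<open>Minimizer of the total Chernoff exponent
    \<open>m * (s^2 * t^2 / 4 - t * s * u)\<close>, with minimum \<open>- m * u^2\<close>.\<close>
  define t where "t = 2 * u / s"
  have t: "t > 0" using s u by (simp add: t_def)
  define S where "S \<omega> = sample_std n (\<lambda>j. X j \<omega>)" for \<omega>
  have rv: "random_variable borel (X i)" if "i \<in> {1..n}" for i
    using ind that by (auto simp: indep_vars_def)
  have [measurable]: "S \<in> borel_measurable M"
    unfolding S_def by (intro borel_measurable_sample_std rv)
  have int: "integrable M (\<lambda>\<omega>. exp (- (t * m) * (S \<omega>)\<^sup>2))"
    using t m by (intro integrable_const_bound[where B = 1] AE_I2) auto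
  have "prob {\<omega> \<in> space M. S \<omega> + u \<le> s} \<le> prob {\<omega> \<in> space M. (S \<omega>)\<^sup>2 \<le> s\<^sup>2 - s * u}"
  proof (intro finite_measure_mono subsetI)
    fix \<omega> assume "\<omega> \<in> {\<omega> \<in> space M. S \<omega> + u \<le> s}"
    then have \<omega>: "\<omega> \<in> space M" "S \<omega> + u \<le> s" by auto
    have S0: "S \<omega> \<ge> 0" using n by (simp add: S_def sample_std_nonneg)
    have "(S \<omega>)\<^sup>2 \<le> (s - u)\<^sup>2" using \<omega> S0 by (intro power_mono) auto
    \<comment> \<open>Nonnegativity of \<open>S\<close> forces \<open>u\<close> to be at most
      \<open>s\<close>, hence \<open>u^2\<close> at most \<open>s * u\<close>.\<close>
    also have "\<dots> \<le> s\<^sup>2 - s * u"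
      using mult_right_mono[of u s u] u \<omega> S0 by (simp add: power2_eq_square algebra_simps)
    finally show "\<omega> \<in> {\<omega> \<in> space M. (S \<omega>)\<^sup>2 \<le> s\<^sup>2 - s * u}" using \<omega> by simp
  qed measurable
  also have "\<dots> \<le> exp (t * m * (s\<^sup>2 - s * u)) * (\<integral>\<omega>\<in>space M. exp (- (t * m) * (S \<omega>)\<^sup>2) \<partial>M)"
    using t m integrable_mult_indicator[OF sets.top int]
    by (intro Chernoff_ineq_le) (simp_all add: set_integrable_def)
  also have "(\<integral>\<omega>\<in>space M. exp (- (t * m) * (S \<omega>)\<^sup>2) \<partial>M) = expectation (\<lambda>\<omega>. exp (- (t * m) * (S \<omega>)\<^sup>2))"
    by (rule set_integral_space[OF int])
  also have "\<dots> \<le> exp (m * (v * (t\<^sup>2 / 4 - t)))"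
    unfolding m_def S_def using t by (intro sample_variance_mgf_le[OF ind n bd mean var]) auto
  also have "exp (t * m * (s\<^sup>2 - s * u)) * exp (m * (v * (t\<^sup>2 / 4 - t))) = exp (- m * u\<^sup>2)"
    using s(1) by (simp add: s(2) t_def power2_eq_square field_simps flip: exp_add)
  also have "\<dots> \<le> exp (- (real n - 1) * u\<^sup>2 / 2)"
    using mult_right_mono[OF m(2), of "u\<^sup>2"] by (simp add: algebra_simps)
  finally show ?thesis by (simp add: S_def s_def)
qed

section \<open>Variance of a score in the unit interval, and transfer to samples\<close>

text \<open>Pointwise \<open>f^2\<close> is at most \<open>f\<close>, so the variance is at most
  \<open>m - m^2\<close> for the mean \<open>m\<close>. This justifies the cap \<open>1 / 2\<close>
  in \<open>sigma_upper\<close>.\<close>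

lemma variance_unit_interval_le:
  fixes f :: "'a \<Rightarrow> real"
  assumes f: "f \<in> borel_measurable M" and bd: "\<And>x. x \<in> space M \<Longrightarrow> 0 \<le> f x \<and> f x \<le> 1"
  shows "variance f \<le> 1 / 4"
proof -
  have int: "integrable M f" "integrable M (\<lambda>x. (f x)\<^sup>2)"
    using f bd by (intro integrable_const_bound[where B = 1] AE_I2; auto intro: power_le_one)+
  have "expectation (\<lambda>x. (f x)\<^sup>2) \<le> expectation f"
    using int bd by (intro integral_mono) (auto simp: power2_eq_square mult_left_le)
  then have "variance f \<le> expectation f - (expectation f)\<^sup>2"
    by (simp add: variance_eq[OF int])
  also have "\<dots> \<le> 1 / 4"
    using zero_le_power2[of "expectation f - 1 / 2"] by (simp add: power2_eq_square algebra_simps)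
  finally show ?thesis .
qed

lemma variance_pos:
  fixes f :: "'a \<Rightarrow> real"
  assumes int: "integrable M (\<lambda>x. (f x - expectation f)\<^sup>2)" and nc: "\<not> (\<exists>c. AE x in M. f x = c)"
  shows "variance f > 0"
proof -
  have "variance f \<noteq> 0"
  proof
    assume "variance f = 0"
    then have "AE x in M. (f x - expectation f)\<^sup>2 = 0"
      using integral_nonneg_eq_0_iff_AE[OF int] by simp
    then show False using nc by auto
  qed
  moreover have "variance f \<ge> 0" by (rule variance_positive)
  ultimately show ?thesis by linarith
qed

lemma iid_sampleD:
  fixes f :: "'y \<Rightarrow> real"
  assumes iid: "iid_sample M P n Y" and f: "f \<in> borel_measurable P"
    and bd: "\<And>y. y \<in> space P \<Longrightarrow> 0 \<le> f y \<and> f y \<le> 1"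
  shows "indep_vars (\<lambda>_. borel) (\<lambda>j \<omega>. f (Y j \<omega>)) {1..n}"
    and "\<And>j. j \<in> {1..n} \<Longrightarrow> (\<lambda>\<omega>. f (Y j \<omega>)) \<in> borel_measurable M"
    and "\<And>j \<omega>. j \<in> {1..n} \<Longrightarrow> \<omega> \<in> space M \<Longrightarrow> f (Y j \<omega>) \<in> {0..1}"
    and "\<And>j. j \<in> {1..n} \<Longrightarrow> expectation (\<lambda>\<omega>. f (Y j \<omega>)) = integral\<^sup>L P f"
    and "\<And>j. j \<in> {1..n} \<Longrightarrow> variance (\<lambda>\<omega>. f (Y j \<omega>)) = (\<integral>y. (f y - integral\<^sup>L P f)\<^sup>2 \<partial>P)"
proof -
  have ind: "indep_vars (\<lambda>_. P) Y {1..n}" and distr: "\<And>j. j \<in> {1..n} \<Longrightarrow> distr M P (Y j) = P"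
    using iid by (auto simp: iid_sample_def)
  have rv: "Y j \<in> measurable M P" if "j \<in> {1..n}" for j
    using ind that by (auto simp: indep_vars_def)
  show "indep_vars (\<lambda>_. borel) (\<lambda>j \<omega>. f (Y j \<omega>)) {1..n}"
    using f by (intro indep_vars_compose2[OF ind])
  fix j assume j: "j \<in> {1..n}"
  note [measurable] = rv[OF j] f
  show "(\<lambda>\<omega>. f (Y j \<omega>)) \<in> borel_measurable M" by measurable
  show "f (Y j \<omega>) \<in> {0..1}" if "\<omega> \<in> space M" for \<omega>
    using bd[OF measurable_space[OF rv[OF j] that]] by simp
  \<comment> \<open>Change of variables along \<open>Y j\<close>, used both for \<open>f\<close> and
    for its squared deviation.\<close>
  have transfer: "expectation (\<lambda>\<omega>. g (Y j \<omega>)) = integral\<^sup>L P g"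
    if "g \<in> borel_measurable P" for g :: "'y \<Rightarrow> real"
    using integral_distr[OF rv[OF j] that] distr[OF j] by simp
  show m: "expectation (\<lambda>\<omega>. f (Y j \<omega>)) = integral\<^sup>L P f" by (rule transfer[OF f])
  show "variance (\<lambda>\<omega>. f (Y j \<omega>)) = (\<integral>y. (f y - integral\<^sup>L P f)\<^sup>2 \<partial>P)"
    unfolding m by (rule transfer) measurable
qed

end

section \<open>Chi-square divergence bounds the efficacy\<close>

lemma efficacy_le_rho:
  fixes f :: "'y \<Rightarrow> real"
  assumes "prob_space P0" "prob_space P1" and sets: "sets P1 = sets P0"
    and ac: "absolutely_continuous P0 P1"
    and f [measurable]: "f \<in> borel_measurable P0"
    and int1: "integrable P1 f" and int0: "integrable P0 f"
    and int2: "integrable P0 (\<lambda>y. (f y - prob_space.expectation P0 f)\<^sup>2)"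
    and pos: "prob_space.variance P0 f > 0"
  shows "ennreal (efficacy P1 P0 f) \<le> rho P1 P0"
proof (cases "chi_square P1 P0 = \<infinity>")
  case True
  then show ?thesis by (simp add: rho_def)
next
  case False
  interpret P0: prob_space P0 by fact
  interpret P1: prob_space P1 by fact
  define r where "r y = enn2real (RN_deriv P0 P1 y)" for y
  have [measurable]: "r \<in> borel_measurable P0" unfolding r_def by measurable
  define \<mu> where "\<mu> = P0.expectation f"
  define v where "v = P0.variance f"
  define D where "D = P1.expectation f - \<mu>"
  \<comment> \<open>Used at the constant 1, which gives the density mean 1, and at \<open>f\<close>,
    which rewrites its mean under \<open>P1\<close> as an integral under \<open>P0\<close>.\<close>
  note RN = P0.RN_deriv_integrable[OF P1.sigma_finite_measure_axioms ac sets]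
    P0.RN_deriv_integral[OF P1.sigma_finite_measure_axioms ac sets]
  have r: "integrable P0 r" "integral\<^sup>L P0 r = 1"
    using RN[of "\<lambda>_. 1"] by (auto simp: r_def[abs_def] P1.prob_space)
  have rf: "integrable P0 (\<lambda>y. r y * f y)" "integral\<^sup>L P0 (\<lambda>y. r y * f y) = P1.expectation f"
    using RN[OF f] int1 by (auto simp: r_def)
  have "(\<lambda>y. (r y - 1) * (f y - \<mu>)) = (\<lambda>y. r y * f y - f y - \<mu> * r y + \<mu>)"
    by (simp add: algebra_simps)
  then have int: "integrable P0 (\<lambda>y. (r y - 1) * (f y - \<mu>))"
    and D: "integral\<^sup>L P0 (\<lambda>y. (r y - 1) * (f y - \<mu>)) = D"
    using r rf int0 by (auto simp: D_def \<mu>_def P0.prob_space)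
  \<comment> \<open>Cauchy-Schwarz is applied to extended nonnegative integrals, so the square of
    \<open>r - 1\<close> raises no integrability condition; finiteness of \<open>chi_square\<close>
    serves only to return to the reals.\<close>
  define a where "a y = ennreal \<bar>r y - 1\<bar>" for y
  define b where "b y = ennreal \<bar>f y - \<mu>\<bar>" for y
  have [measurable]: "a \<in> borel_measurable P0" "b \<in> borel_measurable P0"
    unfolding a_def b_def by measurable
  have "ennreal \<bar>D\<bar> \<le> (\<integral>\<^sup>+y. a y * b y \<partial>P0)"
    using integral_norm_bound_ennreal[OF int] by (simp add: D abs_mult ennreal_mult a_def b_def)
  then have "(ennreal \<bar>D\<bar>)\<^sup>2 \<le> (\<integral>\<^sup>+y. a y * b y \<partial>P0)\<^sup>2" by (rule power_mono) simp
  also have "\<dots> \<le> (\<integral>\<^sup>+y. (a y)\<^sup>2 \<partial>P0) * (\<integral>\<^sup>+y. (b y)\<^sup>2 \<partial>P0)"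
    by (rule Cauchy_Schwarz_nn_integral) measurable
  also have "(\<integral>\<^sup>+y. (a y)\<^sup>2 \<partial>P0) = chi_square P1 P0"
    by (simp add: a_def chi_square_def r_def ennreal_power)
  also have "(\<integral>\<^sup>+y. (b y)\<^sup>2 \<partial>P0) = ennreal v"
    unfolding v_def \<mu>_def[symmetric]
    using int2 by (simp add: b_def ennreal_power nn_integral_eq_integral \<mu>_def)
  also have "chi_square P1 P0 = ennreal (enn2real (chi_square P1 P0))"
    using False by (simp add: less_top)
  finally have "D\<^sup>2 \<le> enn2real (chi_square P1 P0) * v"
    using pos by (simp add: ennreal_power v_def flip: ennreal_mult)
  then have "sqrt (D\<^sup>2) \<le> sqrt (enn2real (chi_square P1 P0)) * sqrt v"
    by (metis real_sqrt_le_mono real_sqrt_mult)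
  then have "efficacy P1 P0 f \<le> sqrt (enn2real (chi_square P1 P0))"
    using pos by (simp add: efficacy_def std_dev_def D_def \<mu>_def v_def pos_divide_le_eq)
  then show ?thesis using False by (simp add: rho_def ennreal_leI)
qed

section \<open>Assembly of the confidence bound\<close>

text \<open>The deterministic part on the good event: by the triangle inequality the numerator
  underestimates the mean gap, and the denominator overestimates \<open>\<sigma>\<close>. Clipping
  at 0 is harmless because the gap is nonnegative.\<close>

lemma efficacy_lower_le:
  fixes \<mu>0 \<mu>1 \<sigma> :: real
  assumes "\<bar>sample_mean n0 x0 - \<mu>0\<bar> \<le> eps \<delta> n0" "\<bar>sample_mean n1 x1 - \<mu>1\<bar> \<le> eps \<delta> n1"
    and "\<sigma> \<le> sample_std n0 x0 + u_dev \<delta> n0" "\<sigma> \<le> 1 / 2" "\<sigma> > 0"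
  shows "efficacy_lower \<delta> n0 n1 x0 x1 \<le> \<bar>\<mu>1 - \<mu>0\<bar> / \<sigma>"
  unfolding efficacy_lower_def
  by (rule frac_le) (use assms in \<open>auto simp: Delta_lower_def sigma_upper_def\<close>)

theorem corollary9:
  fixes P0 P1 :: "'y measure"
    and M :: "'w measure"
    and f :: "'y \<Rightarrow> real"
    and Y0 Y1 :: "nat \<Rightarrow> 'w \<Rightarrow> 'y"
    and n0 n1 :: nat
    and \<delta> :: real
  assumes "prob_space P0" and "prob_space P1"
    and "sets P1 = sets P0"
    and "absolutely_continuous P0 P1"
    and "f \<in> borel_measurable P0"
    and "\<And>y. y \<in> space P0 \<Longrightarrow> 0 \<le> f y \<and> f y \<le> 1"
    and "\<not> (\<exists>c. AE y in P0. f y = c)"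
    and "n0 \<ge> 2" and "n1 \<ge> 1"
    and "prob_space M"
    and "iid_sample M P0 n0 Y0"
    and "iid_sample M P1 n1 Y1"
    and "0 < \<delta>" and "\<delta> < 1"
  shows "measure M {\<omega> \<in> space M.
           rho P1 P0 \<ge> ennreal (efficacy P1 P0 f) \<and>
           efficacy P1 P0 f \<ge>
             efficacy_lower \<delta> n0 n1 (\<lambda>j. f (Y0 j \<omega>)) (\<lambda>k. f (Y1 k \<omega>))} \<ge> 1 - \<delta>"
proof -
  interpret P0: prob_space P0 by fact
  interpret P1: prob_space P1 by fact
  interpret M: prob_space M by fact
  note f = \<open>f \<in> borel_measurable P0\<close> and bd = assms(6) and \<delta> = \<open>0 < \<delta>\<close> \<open>\<delta> < 1\<close>
  have f1: "f \<in> borel_measurable P1" using f assms(3) by (simp cong: measurable_cong_sets)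
  have bd1: "0 \<le> f y \<and> f y \<le> 1" if "y \<in> space P1" for y
    using bd sets_eq_imp_space_eq[OF assms(3)] that by simp
  note I0 = M.iid_sampleD[OF assms(11) f bd] and I1 = M.iid_sampleD[OF assms(12) f1 bd1]
  define \<mu>0 where "\<mu>0 = P0.expectation f"
  define \<mu>1 where "\<mu>1 = P1.expectation f"
  define v where "v = P0.variance f"
  have int0: "integrable P0 f" using f bd by (intro P0.integrable_const_bound[where B = 1] AE_I2) auto
  have int1: "integrable P1 f" using f1 bd1 by (intro P1.integrable_const_bound[where B = 1] AE_I2) auto
  have intsq: "integrable P0 (\<lambda>y. (f y)\<^sup>2)"
    using f bd by (intro P0.integrable_const_bound[where B = 1] AE_I2) (auto intro: power_le_one)
  have int2: "integrable P0 (\<lambda>y. (f y - P0.expectation f)\<^sup>2)"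
    using int0 intsq by (simp add: power2_diff)
  have vpos: "v > 0" unfolding v_def by (rule P0.variance_pos[OF int2 assms(7)])
  have vle: "sqrt v \<le> 1 / 2"
    using P0.variance_unit_interval_le[OF f bd] by (intro real_le_lsqrt) (auto simp: v_def power2_eq_square)
  have rho: "ennreal (efficacy P1 P0 f) \<le> rho P1 P0"
    using efficacy_le_rho[OF assms(1-4) f int1 int0 int2] vpos by (simp add: v_def)
  have eff: "efficacy P1 P0 f = \<bar>\<mu>1 - \<mu>0\<bar> / sqrt v"
    by (simp add: efficacy_def std_dev_def \<mu>0_def \<mu>1_def v_def)
  \<comment> \<open>The 6 in \<open>eps\<close> absorbs the factor 2 of the two-sided bound;
    \<open>u_dev\<close> below belongs to a one-sided bound, so it has a 3. Each failure then costs
    \<open>\<delta> / 3\<close>.\<close>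
  have eps: "eps \<delta> n \<ge> 0" "2 * exp (- 2 * real n * (eps \<delta> n)\<^sup>2) = \<delta> / 3" if "n \<ge> 1" for n
  proof -
    have "ln (6 / \<delta>) \<ge> 0" using \<delta> by simp
    then show "eps \<delta> n \<ge> 0" "2 * exp (- 2 * real n * (eps \<delta> n)\<^sup>2) = \<delta> / 3"
      using that \<delta> by (auto simp: eps_def exp_minus)
  qed
  have u: "u_dev \<delta> n0 > 0" "exp (- (real n0 - 1) * (u_dev \<delta> n0)\<^sup>2 / 2) = \<delta> / 3"
  proof -
    have ln: "ln (3 / \<delta>) > 0" using \<delta> by simp
    then show "u_dev \<delta> n0 > 0" using \<open>n0 \<ge> 2\<close> by (simp add: u_dev_def)
    have "(u_dev \<delta> n0)\<^sup>2 = 2 * ln (3 / \<delta>) / (real n0 - 1)"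
      using ln \<open>n0 \<ge> 2\<close> by (simp add: u_dev_def)
    then have "(real n0 - 1) * (u_dev \<delta> n0)\<^sup>2 = 2 * ln (3 / \<delta>)" using \<open>n0 \<ge> 2\<close> by simp
    then have "- (real n0 - 1) * (u_dev \<delta> n0)\<^sup>2 / 2 = - ln (3 / \<delta>)" by linarith
    then show "exp (- (real n0 - 1) * (u_dev \<delta> n0)\<^sup>2 / 2) = \<delta> / 3"
      using \<delta> by (simp add: exp_minus)
  qed
  have n0: "n0 \<ge> 1" using \<open>n0 \<ge> 2\<close> by simp
  define S0 where "S0 \<omega> = sample_mean n0 (\<lambda>j. f (Y0 j \<omega>))" for \<omega>
  define S1 where "S1 \<omega> = sample_mean n1 (\<lambda>j. f (Y1 j \<omega>))" for \<omega>
  define T where "T \<omega> = sample_std n0 (\<lambda>j. f (Y0 j \<omega>))" for \<omega>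
  have [measurable]: "S0 \<in> borel_measurable M" "S1 \<in> borel_measurable M" "T \<in> borel_measurable M"
    unfolding S0_def S1_def T_def
    by (intro borel_measurable_sample_mean borel_measurable_sample_std I0(2) I1(2); assumption)+
  let ?G = "{\<omega> \<in> space M. rho P1 P0 \<ge> ennreal (efficacy P1 P0 f) \<and> efficacy P1 P0 f \<ge>
             efficacy_lower \<delta> n0 n1 (\<lambda>j. f (Y0 j \<omega>)) (\<lambda>k. f (Y1 k \<omega>))}"
  \<comment> \<open>The three failure events. The inequality with \<open>rho\<close> involves no
    sample and holds outright, so the union bound over these three suffices.\<close>
  define B0 where "B0 = {\<omega> \<in> space M. \<bar>S0 \<omega> - \<mu>0\<bar> \<ge> eps \<delta> n0}"
  define B1 where "B1 = {\<omega> \<in> space M. \<bar>S1 \<omega> - \<mu>1\<bar> \<ge> eps \<delta> n1}"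
  define B2 where "B2 = {\<omega> \<in> space M. T \<omega> + u_dev \<delta> n0 \<le> sqrt v}"
  have [measurable]: "B0 \<in> sets M" "B1 \<in> sets M" "B2 \<in> sets M"
    unfolding B0_def B1_def B2_def by measurable
  have G: "?G \<in> sets M"
    unfolding efficacy_lower_def Delta_lower_def sigma_upper_def S0_def[symmetric] S1_def[symmetric] T_def[symmetric]
    by measurable
  have "M.prob B0 \<le> \<delta> / 3"
    unfolding B0_def S0_def eps(2)[OF n0, symmetric]
    by (rule M.sample_mean_tail[OF I0(1) n0 I0(3) _ eps(1)[OF n0]]) (auto simp: I0(4) \<mu>0_def)
  moreover have "M.prob B1 \<le> \<delta> / 3"
    unfolding B1_def S1_def eps(2)[OF assms(9), symmetric]
    by (rule M.sample_mean_tail[OF I1(1) assms(9) I1(3) _ eps(1)[OF assms(9)]]) (auto simp: I1(4) \<mu>1_def)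
  moreover have "M.prob B2 \<le> \<delta> / 3"
    unfolding B2_def T_def u(2)[symmetric] v_def
    by (rule M.sample_std_lower_tail[OF I0(1) assms(8) I0(3-5) _ u(1)]) (use vpos in \<open>auto simp: v_def\<close>)
  moreover have "M.prob (B0 \<union> B1 \<union> B2) \<le> M.prob B0 + M.prob B1 + M.prob B2"
    using measure_Un_le[of "B0 \<union> B1" M B2] measure_Un_le[of B0 M B1] by simp
  ultimately have "M.prob (B0 \<union> B1 \<union> B2) \<le> \<delta>" by simp
  then have "1 - \<delta> \<le> M.prob (space M - (B0 \<union> B1 \<union> B2))"
    by (subst M.prob_compl) auto
  also have "\<dots> \<le> M.prob ?G"
  proof (intro M.finite_measure_mono G subsetI)
    fix \<omega> assume "\<omega> \<in> space M - (B0 \<union> B1 \<union> B2)"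
    then have \<omega>: "\<omega> \<in> space M" "\<bar>S0 \<omega> - \<mu>0\<bar> \<le> eps \<delta> n0" "\<bar>S1 \<omega> - \<mu>1\<bar> \<le> eps \<delta> n1"
      "sqrt v \<le> T \<omega> + u_dev \<delta> n0"
      by (auto simp: B0_def B1_def B2_def)
    then show "\<omega> \<in> ?G"
      using efficacy_lower_le[OF \<omega>(2-4)[unfolded S0_def S1_def T_def] vle] vpos rho eff by simp
  qed
  finally show ?thesis .
qed

end
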